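(* Let $n\ge 2$ and let $Q_{4n}=\langle x,y \mid y^{2n}=1,\ x^2=y^n,\ xyx^{-1}=y^{-1}\rangle$ be the dicyclic (generalized quaternion) group of order $4n$. Then \[\gamma(\Gamma_c(Q_{4n}))=\gamma(K_{2(n-1)}).\]
   Context: For a non-abelian group $G$ with center $Z(G)$, the commuting graph $\Gamma_c(G)$ is the simple undirected graph with vertex set $G\setminus Z(G)$, in which two distinct vertices $x,y$ are adjacent if and only if $xy=yx$. The genus $\gamma(\Gamma)$ of a graph $\Gamma$ is the smallest non-negative integer $n$ such that $\Gamma$ can be embedded on the surface obtained by attaching $n$ handles to a sphere. $K_m$ denotes the complete graph on $m$ vertices. *)

theory Defs
  imports "HOL-Analysis.Analysis" "HOL-Algebra.Group"
begin

section \<open>Groups given by generators and relations\<close>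

text \<open>
  A word is a list of letters; the letter \<open>(g, True)\<close> stands for the generator \<open>g\<close> and
  \<open>(g, False)\<close> for its formal inverse.  A pair \<open>(l, r) \<in> R\<close> is the relation \<open>l = r\<close>.
  Every element of the type \<open>'g\<close> is a generator.
\<close>

type_synonym 'g word = "('g \<times> bool) list"

inductive_set pres_rel :: "('g word \<times> 'g word) set \<Rightarrow> ('g word \<times> 'g word) set"
  for R where
  refl: "(w, w) \<in> pres_rel R"
| sym: "(v, w) \<in> pres_rel R \<Longrightarrow> (w, v) \<in> pres_rel R"
| trans: "(u, v) \<in> pres_rel R \<Longrightarrow> (v, w) \<in> pres_rel R \<Longrightarrow> (u, w) \<in> pres_rel R"
| cancel: "(u @ [(g, b), (g, \<not> b)] @ v, u @ v) \<in> pres_rel R"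
| relation: "(l, r) \<in> R \<Longrightarrow> (u @ l @ v, u @ r @ v) \<in> pres_rel R"

definition presented_group :: "('g word \<times> 'g word) set \<Rightarrow> 'g word set monoid" where
  "presented_group R =
     \<lparr>carrier = UNIV // pres_rel R,
      mult = (\<lambda>A B. {w. \<exists>u\<in>A. \<exists>v\<in>B. (u @ v, w) \<in> pres_rel R}),
      one = pres_rel R `` {[]}\<rparr>"

lemma equiv_pres_rel: "equiv UNIV (pres_rel R)"
  by (intro equivI refl_onI symI transI) (auto intro: pres_rel.intros)

lemma pres_rel_append_left: "(u, v) \<in> pres_rel R \<Longrightarrow> (w @ u, w @ v) \<in> pres_rel R"
proof (induction rule: pres_rel.induct)
  case (cancel u g b v)
  show ?case using pres_rel.cancel[of "w @ u" g b v R] by simp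
next
  case (relation l r u v)
  show ?case using pres_rel.relation[OF relation, of "w @ u" v] by simp
qed (blast intro: pres_rel.intros)+

lemma pres_rel_append_right: "(u, v) \<in> pres_rel R \<Longrightarrow> (u @ w, v @ w) \<in> pres_rel R"
proof (induction rule: pres_rel.induct)
  case (cancel u g b v)
  show ?case using pres_rel.cancel[of u g b "v @ w" R] by simp
next
  case (relation l r u v)
  show ?case using pres_rel.relation[OF relation, of u "v @ w"] by simp
qed (blast intro: pres_rel.intros)+

lemma pres_rel_append:
  "(u, u') \<in> pres_rel R \<Longrightarrow> (v, v') \<in> pres_rel R \<Longrightarrow> (u @ v, u' @ v') \<in> pres_rel R"
  by (meson pres_rel.trans pres_rel_append_left pres_rel_append_right)

lemma pres_class_eq_iff: "pres_rel R `` {u} = pres_rel R `` {v} \<longleftrightarrow> (u, v) \<in> pres_rel R"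
  using eq_equiv_class_iff[OF equiv_pres_rel] by blast

lemma mult_presented_group:
  "(pres_rel R `` {u}) \<otimes>\<^bsub>presented_group R\<^esub> (pres_rel R `` {v}) = pres_rel R `` {u @ v}"
proof -
  have "(\<exists>u'\<in>pres_rel R `` {u}. \<exists>v'\<in>pres_rel R `` {v}. (u' @ v', w) \<in> pres_rel R)
        \<longleftrightarrow> (u @ v, w) \<in> pres_rel R" for w
    by (auto intro: pres_rel.refl pres_rel.trans[OF pres_rel_append])
  then show ?thesis
    by (auto simp: presented_group_def)
qed

lemma one_presented_group: "\<one>\<^bsub>presented_group R\<^esub> = pres_rel R `` {[]}"
  by (simp add: presented_group_def)

lemma carrier_presented_group:
  "carrier (presented_group R) = range (\<lambda>w. pres_rel R `` {w})"
  by (auto simp: presented_group_def quotient_def)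

lemma pres_rel_inverse: "\<exists>v. (v @ w, []) \<in> pres_rel R"
proof (induction w)
  case Nil
  show ?case by (rule exI[of _ "[]"]) (simp add: pres_rel.refl)
next
  case (Cons a w)
  obtain g b where a: "a = (g, b)" by (cases a)
  from Cons obtain v where v: "(v @ w, []) \<in> pres_rel R" by blast
  have "((v @ [(g, \<not> b)]) @ a # w, v @ w) \<in> pres_rel R"
    using pres_rel.cancel[of v g "\<not> b" w R] by (simp add: a)
  with v show ?case by (blast intro: pres_rel.trans)
qed

lemma group_presented_group: "group (presented_group R)"
proof (rule groupI)
  fix x assume "x \<in> carrier (presented_group R)"
  then obtain w where w: "x = pres_rel R `` {w}" by (auto simp: carrier_presented_group)
  obtain v where "(v @ w, []) \<in> pres_rel R" using pres_rel_inverse by blast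
  then show "\<exists>y\<in>carrier (presented_group R). y \<otimes>\<^bsub>presented_group R\<^esub> x = \<one>\<^bsub>presented_group R\<^esub>"
    by (auto simp: carrier_presented_group w mult_presented_group one_presented_group
        pres_class_eq_iff)
qed (auto simp: carrier_presented_group mult_presented_group one_presented_group)

section \<open>The dicyclic group\<close>

datatype dic_gen = X | Y

definition dicyclic_relations :: "nat \<Rightarrow> (dic_gen word \<times> dic_gen word) set" where
  "dicyclic_relations n =
     {(replicate (2 * n) (Y, True), []),
      ([(X, True), (X, True)], replicate n (Y, True)),
      ([(X, True), (Y, True), (X, False)], [(Y, False)])}"

text \<open>\<open>dicyclic_group n\<close> is the group of order \<open>4 * n\<close>.\<close>

definition dicyclic_group :: "nat \<Rightarrow> dic_gen word set monoid" where
  "dicyclic_group n = presented_group (dicyclic_relations n)"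

section \<open>Simple graphs\<close>

record 'v sgraph =
  verts :: "'v set"
  edges :: "'v set set"

definition complete_graph :: "'v set \<Rightarrow> 'v sgraph" where
  "complete_graph V = \<lparr>verts = V, edges = {{u, v} | u v. u \<in> V \<and> v \<in> V \<and> u \<noteq> v}\<rparr>"

definition group_center :: "('a, 'b) monoid_scheme \<Rightarrow> 'a set" where
  "group_center G = {z \<in> carrier G. \<forall>g\<in>carrier G. z \<otimes>\<^bsub>G\<^esub> g = g \<otimes>\<^bsub>G\<^esub> z}"

definition commuting_graph :: "('a, 'b) monoid_scheme \<Rightarrow> 'a sgraph" where
  "commuting_graph G =
     \<lparr>verts = carrier G - group_center G,
      edges = {{x, y} | x y. x \<in> carrier G - group_center G \<and> y \<in> carrier G - group_center G
                 \<and> x \<noteq> y \<and> x \<otimes>\<^bsub>G\<^esub> y = y \<otimes>\<^bsub>G\<^esub> x}\<rparr>"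

section \<open>The sphere with handles\<close>

definition axis_dist :: "nat \<Rightarrow> real ^ 3 \<Rightarrow> real" where
  "axis_dist i p = sqrt ((p $ 1 - real i)\<^sup>2 + (p $ 2)\<^sup>2)"

text \<open>
  The sphere with \<open>n\<close> handles, as a subset of Euclidean 3-space.  From the sphere of radius
  \<open>n + 1\<close> we remove, for each \<open>i < n\<close>, the two opposite open discs cut out by the solid cylinder
  of radius \<open>1/4\<close> about the vertical axis through \<open>(i, 0, 0)\<close>, and we attach the part of the
  lateral surface of that cylinder inside the ball: a tube joining the two boundary circles.
  The discs, and the tubes, are pairwise disjoint, since the axes are at distance at least 1.
  The tubes run inside the ball, so the surface is the boundary of a ball with \<open>n\<close> tunnels
  drilled through it; in particular it is orientable.
\<close>

definition sphere_with_handles :: "nat \<Rightarrow> (real ^ 3) set" where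
  "sphere_with_handles n =
     {p \<in> sphere 0 (real n + 1). \<forall>i<n. axis_dist i p \<ge> 1/4} \<union>
     {p \<in> cball 0 (real n + 1). \<exists>i<n. axis_dist i p = 1/4}"

section \<open>Embeddings and genus\<close>

text \<open>
  An embedding sends vertices to distinct points and edges to arcs joining the images of their
  ends, such that an arc contains no vertices other than its ends and two arcs meet only in
  common ends.
\<close>

definition embeddable :: "'v sgraph \<Rightarrow> 'p::topological_space set \<Rightarrow> bool" where
  "embeddable G S \<longleftrightarrow>
     (\<exists>(pt :: 'v \<Rightarrow> 'p) (crv :: 'v set \<Rightarrow> real \<Rightarrow> 'p).
        inj_on pt (verts G) \<and> pt ` verts G \<subseteq> S \<and>
        (\<forall>e\<in>edges G. arc (crv e) \<and> path_image (crv e) \<subseteq> S \<and>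
           {pathstart (crv e), pathfinish (crv e)} = pt ` e) \<and>
        (\<forall>e\<in>edges G. \<forall>v\<in>verts G. pt v \<in> path_image (crv e) \<longrightarrow> v \<in> e) \<and>
        (\<forall>e\<in>edges G. \<forall>f\<in>edges G. e \<noteq> f \<longrightarrow>
           path_image (crv e) \<inter> path_image (crv f) \<subseteq> pt ` (e \<inter> f)))"

definition genus :: "'v sgraph \<Rightarrow> nat" where
  "genus G = (LEAST n. embeddable G (sphere_with_handles n))"

end

theory Submission
  imports Defs
begin

text \<open>
  The elements of the dicyclic group are \<open>y\<^sup>k\<close> and \<open>y\<^sup>k x\<close> with \<open>0 \<le> k < 2n\<close>, and its center is
  \<open>{1, y\<^sup>n}\<close>.  The \<open>2(n - 1)\<close> noncentral powers of \<open>y\<close> commute with each other, whereas \<open>y\<^sup>k x\<close>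
  commutes with no other noncentral element than \<open>y\<^bsup>k+n\<^esup> x\<close>.  Hence the commuting graph is the
  disjoint union of \<open>K\<^bsub>2(n-1)\<^esub>\<close> and \<open>n\<close> copies of \<open>K\<^sub>2\<close>.  Adding a disjoint edge to a finite graph
  embedded in a surface is always possible: by invariance of dimension an arc contains no open
  piece of the surface, so finitely many arcs miss some open piece, which has room for the edge.
\<close>

section \<open>Graph embeddings\<close>

lemma embeddableE:
  fixes G :: "'v sgraph" and S :: "'p::topological_space set"
  assumes "embeddable G S"
  obtains pt :: "'v \<Rightarrow> 'p" and crv :: "'v set \<Rightarrow> real \<Rightarrow> 'p" where
    "inj_on pt (verts G)" "pt ` verts G \<subseteq> S"
    "\<And>e. e \<in> edges G \<Longrightarrow> arc (crv e)"
    "\<And>e. e \<in> edges G \<Longrightarrow> path_image (crv e) \<subseteq> S"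
    "\<And>e. e \<in> edges G \<Longrightarrow> {pathstart (crv e), pathfinish (crv e)} = pt ` e"
    "\<And>e v. e \<in> edges G \<Longrightarrow> v \<in> verts G \<Longrightarrow> pt v \<in> path_image (crv e) \<Longrightarrow> v \<in> e"
    "\<And>e f. e \<in> edges G \<Longrightarrow> f \<in> edges G \<Longrightarrow> e \<noteq> f \<Longrightarrow>
       path_image (crv e) \<inter> path_image (crv f) \<subseteq> pt ` (e \<inter> f)"
  using assms unfolding embeddable_def
  apply (elim exE conjE)
  subgoal for pt crv by (rule that[of pt crv]) simp_all
  done

section \<open>Transfer of embeddings along vertex maps\<close>

text \<open>A drawing of \<open>H\<close> is pulled back along \<open>f\<close>: a vertex goes to
  the point of its image, an edge is drawn by the curve of its image. Injectivity keeps distinct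
  edges distinct and makes images commute with intersections. With \<open>f\<close> the identity
  this restricts a drawing to a subgraph.\<close>

lemma embeddable_vertex_map:
  assumes emb: "embeddable H S"
    and inj: "inj_on f (verts G)" and verts: "f ` verts G \<subseteq> verts H"
    and edges: "\<And>e. e \<in> edges G \<Longrightarrow> e \<subseteq> verts G \<and> f ` e \<in> edges H"
  shows "embeddable G S"
proof -
  from emb obtain pt crv where
    pt: "inj_on pt (verts H)" "pt ` verts H \<subseteq> S" and
    crv: "\<And>e. e \<in> edges H \<Longrightarrow> arc (crv e)"
      "\<And>e. e \<in> edges H \<Longrightarrow> path_image (crv e) \<subseteq> S"
      "\<And>e. e \<in> edges H \<Longrightarrow> {pathstart (crv e), pathfinish (crv e)} = pt ` e" and
    vtx: "\<And>e v. e \<in> edges H \<Longrightarrow> v \<in> verts H \<Longrightarrow> pt v \<in> path_image (crv e) \<Longrightarrow> v \<in> e" and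
    disj: "\<And>e e'. e \<in> edges H \<Longrightarrow> e' \<in> edges H \<Longrightarrow> e \<noteq> e' \<Longrightarrow>
      path_image (crv e) \<inter> path_image (crv e') \<subseteq> pt ` (e \<inter> e')"
    by (rule embeddableE) blast
  show ?thesis unfolding embeddable_def
  proof (intro exI[of _ "pt \<circ> f"] exI[of _ "\<lambda>e. crv (f ` e)"] conjI ballI impI)
    show "inj_on (pt \<circ> f) (verts G)"
      using inj pt(1) verts by (meson comp_inj_on inj_on_subset)
    show "(pt \<circ> f) ` verts G \<subseteq> S" using pt(2) verts by auto
  next
    fix e assume e: "e \<in> edges G"
    with crv edges show "arc (crv (f ` e))" "path_image (crv (f ` e)) \<subseteq> S"
      "{pathstart (crv (f ` e)), pathfinish (crv (f ` e))} = (pt \<circ> f) ` e"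
      by (simp_all add: image_comp)
  next
    fix e v assume e: "e \<in> edges G" and v: "v \<in> verts G"
      and "(pt \<circ> f) v \<in> path_image (crv (f ` e))"
    then have "f v \<in> f ` e" using vtx edges verts by auto
    then show "v \<in> e" using inj e v edges by (meson inj_on_image_mem_iff)
  next
    fix e e' assume e: "e \<in> edges G" "e' \<in> edges G" "e \<noteq> e'"
    have "f ` e \<noteq> f ` e'" using e edges inj by (metis inj_on_image_eq_iff)
    moreover have "f ` (e \<inter> e') = f ` e \<inter> f ` e'" using e edges inj by (metis inj_on_image_Int)
    ultimately show "path_image (crv (f ` e)) \<inter> path_image (crv (f ` e')) \<subseteq> (pt \<circ> f) ` (e \<inter> e')"
      using disj edges e by (metis image_comp)
  qed
qed

lemma embeddable_complete_graph_card_aux: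
  assumes "finite V" "finite W" "card V = card W" "embeddable (complete_graph V) S"
  shows "embeddable (complete_graph W) S"
proof -
  obtain f where f: "bij_betw f W V"
    using finite_same_card_bij[OF assms(2,1) assms(3)[symmetric]] by blast
  show ?thesis
  proof (rule embeddable_vertex_map[OF assms(4), of f])
    show "inj_on f (verts (complete_graph W))"
      "f ` verts (complete_graph W) \<subseteq> verts (complete_graph V)"
      using f by (auto simp: complete_graph_def bij_betw_def)
    fix e assume "e \<in> edges (complete_graph W)"
    then obtain u v where uv: "e = {u, v}" "u \<in> W" "v \<in> W" "u \<noteq> v"
      by (auto simp: complete_graph_def)
    then have "f u \<in> V" "f v \<in> V" "f u \<noteq> f v" using f by (auto simp: bij_betw_def inj_on_def)
    with uv show "e \<subseteq> verts (complete_graph W) \<and> f ` e \<in> edges (complete_graph V)"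
      by (auto simp: complete_graph_def)
  qed
qed

text \<open>Serves to exchange the complete graph on elements of the group for the one on natural
  numbers.\<close>

lemma embeddable_complete_graph_card:
  assumes "finite V" "finite W" "card V = card W"
  shows "embeddable (complete_graph V) S \<longleftrightarrow> embeddable (complete_graph W) S"
proof
  show "embeddable (complete_graph V) S \<Longrightarrow> embeddable (complete_graph W) S"
    by (rule embeddable_complete_graph_card_aux[OF assms])
  show "embeddable (complete_graph W) S \<Longrightarrow> embeddable (complete_graph V) S"
    by (rule embeddable_complete_graph_card_aux[OF assms(2,1) assms(3)[symmetric]])
qed

section \<open>Open pieces missed by finitely many points and arcs\<close>

text \<open>As a continuous injection of a compact interval into a Hausdorff space, \<open>g\<close>
  is a homeomorphism onto its image. Following \<open>\<phi>\<close> by its inverse would map an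
  open set of dimension at least 2 continuously and injectively into the real line, against
  invariance of dimension.\<close>

lemma arc_contains_no_open_image:
  fixes \<phi> :: "'a::euclidean_space \<Rightarrow> 'p::t2_space"
  assumes "2 \<le> DIM('a)" "continuous_on W \<phi>" "inj_on \<phi> W" "open W" "W \<noteq> {}" "arc g"
  shows "\<not> \<phi> ` W \<subseteq> path_image g"
proof
  assume sub: "\<phi> ` W \<subseteq> path_image g"
  obtain h where h: "homeomorphism {0..1} (path_image g) g h"
    using homeomorphism_compact[of "{0..1::real}" g "path_image g"] \<open>arc g\<close>
    by (auto simp: arc_def path_def path_image_def)
  have "continuous_on W (h \<circ> \<phi>)"
    using h assms(2) sub by (meson continuous_on_compose continuous_on_subset homeomorphism_def)
  moreover have "inj_on (h \<circ> \<phi>) W"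
    using h assms(3) sub
    by (metis comp_inj_on homeomorphism_apply2 inj_on_inverseI inj_on_subset)
  ultimately have "DIM('a) \<le> DIM(real)"
    using invariance_of_dimension assms by blast
  then show False using assms by simp
qed

text \<open>A nonempty open set in Euclidean space is infinite. This does for the vertices what the
  preceding lemma does for the edges.\<close>

lemma finite_contains_no_open_image:
  fixes \<phi> :: "'a::euclidean_space \<Rightarrow> 'p"
  assumes "inj_on \<phi> W" "open W" "W \<noteq> {}" "finite P"
  shows "\<not> \<phi> ` W \<subseteq> P"
  using assms finite_imp_not_open[of W] finite_subset[of "\<phi> ` W" P] finite_imageD[of \<phi> W] by blast

text \<open>Induction on \<open>F\<close>: at each stage the open set shrinks to the part that
  \<open>\<phi>\<close> sends outside the next closed set. That part is open by continuity and
  nonempty by the last assumption.\<close>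

lemma open_image_avoiding_closed_sets:
  fixes \<phi> :: "'a::topological_space \<Rightarrow> 'p::topological_space"
  assumes "finite F" "open V" "V \<noteq> {}" "continuous_on V \<phi>" "\<And>C. C \<in> F \<Longrightarrow> closed C"
    and "\<And>C W. C \<in> F \<Longrightarrow> open W \<Longrightarrow> W \<noteq> {} \<Longrightarrow> W \<subseteq> V \<Longrightarrow> \<not> \<phi> ` W \<subseteq> C"
  shows "\<exists>W. open W \<and> W \<noteq> {} \<and> W \<subseteq> V \<and> \<phi> ` W \<inter> \<Union>F = {}"
  using assms(1,5,6)
proof (induction F rule: finite_induct)
  case empty
  then show ?case using assms by auto
next
  case (insert C F)
  then obtain W where W: "open W" "W \<noteq> {}" "W \<subseteq> V" "\<phi> ` W \<inter> \<Union>F = {}" by auto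
  have "open (W \<inter> \<phi> -` (- C))"
    using W insert.prems(1)[of C] assms(4)
    by (meson continuous_on_subset continuous_open_preimage insertI1 open_Compl)
  moreover have "W \<inter> \<phi> -` (- C) \<noteq> {}" using insert.prems(2)[of C W] W by blast
  ultimately show ?case using W by (intro exI[of _ "W \<inter> \<phi> -` (- C)"]) auto
qed

section \<open>Adding disjoint edges to an embedded graph\<close>

text \<open>The vertex points and the curves of \<open>G\<close> are finitely many closed sets, none
  of which contains the image of a nonempty open part of \<open>V\<close>. So some open
  \<open>W\<close> is mapped away from the whole drawing, and the new edge is the image of a segment
  in \<open>W\<close>.\<close>

lemma embeddable_insert_isolated_edge:
  fixes G :: "'v sgraph" and S :: "'p::t2_space set" and \<phi> :: "'a::euclidean_space \<Rightarrow> 'p"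
  assumes emb: "embeddable G S" and fin: "finite (verts G)" and edges: "edges G \<subseteq> Pow (verts G)"
    and ab: "a \<noteq> b" "a \<notin> verts G" "b \<notin> verts G"
    and chart: "2 \<le> DIM('a)" "open V" "V \<noteq> {}" "continuous_on V \<phi>" "inj_on \<phi> V" "\<phi> ` V \<subseteq> S"
  shows "embeddable \<lparr>verts = {a, b} \<union> verts G, edges = insert {a, b} (edges G)\<rparr> S"
proof -
  from emb obtain pt crv where
    pt: "inj_on pt (verts G)" "pt ` verts G \<subseteq> S" and
    crv: "\<And>e. e \<in> edges G \<Longrightarrow> arc (crv e)"
      "\<And>e. e \<in> edges G \<Longrightarrow> path_image (crv e) \<subseteq> S"
      "\<And>e. e \<in> edges G \<Longrightarrow> {pathstart (crv e), pathfinish (crv e)} = pt ` e" and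
    vtx: "\<And>e v. e \<in> edges G \<Longrightarrow> v \<in> verts G \<Longrightarrow> pt v \<in> path_image (crv e) \<Longrightarrow> v \<in> e" and
    disj: "\<And>e e'. e \<in> edges G \<Longrightarrow> e' \<in> edges G \<Longrightarrow> e \<noteq> e' \<Longrightarrow>
      path_image (crv e) \<inter> path_image (crv e') \<subseteq> pt ` (e \<inter> e')"
    by (rule embeddableE) blast
  \<comment> \<open>The vertex points form a member of their own, since an isolated vertex need not
    lie on any curve.\<close>
  let ?F = "insert (pt ` verts G) ((path_image \<circ> crv) ` edges G)"
  have "\<exists>W. open W \<and> W \<noteq> {} \<and> W \<subseteq> V \<and> \<phi> ` W \<inter> \<Union>?F = {}"
  proof (rule open_image_avoiding_closed_sets[OF _ chart(2-4)])
    show "finite ?F" using fin edges by (simp add: finite_subset)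
    show "closed C" if "C \<in> ?F" for C
    proof (cases "C = pt ` verts G")
      case True
      then show ?thesis using fin by (simp add: finite_imp_closed)
    next
      case False
      with that obtain e where "e \<in> edges G" "C = path_image (crv e)" by auto
      then show ?thesis using crv(1) by (simp add: compact_imp_closed compact_arc_image)
    qed
    show "\<not> \<phi> ` W \<subseteq> C" if "C \<in> ?F" "open W" "W \<noteq> {}" "W \<subseteq> V" for C W
    proof (cases "C = pt ` verts G")
      case True
      then show ?thesis
        using finite_contains_no_open_image[of \<phi> W C] that chart(5) fin inj_on_subset by blast
    next
      case False
      with that(1) have "C \<in> (path_image \<circ> crv) ` edges G" by blast
      then obtain e where "e \<in> edges G" "C = path_image (crv e)" by auto
      then show ?thesis
        using arc_contains_no_open_image[of W \<phi> "crv e"] that chart crv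
        by (meson continuous_on_subset inj_on_subset)
    qed
  qed
  then obtain W where W: "open W" "W \<noteq> {}" "W \<subseteq> V" and avoid: "\<phi> ` W \<inter> \<Union>?F = {}"
    by (elim exE conjE)
  have avoid_pt: "\<phi> z \<noteq> pt v" if "v \<in> verts G" "z \<in> W" for v z
    using avoid that by auto
  have avoid_crv: "\<phi> z \<notin> path_image (crv e)" if "e \<in> edges G" "z \<in> W" for e z
    using avoid that by auto
  from W obtain z r where r: "r > 0" "cball z r \<subseteq> W"
    by (metis ex_in_conv open_contains_cball)
  \<comment> \<open>A second point of the ball serves as the other end of the segment; convexity of
    the ball keeps the segment inside \<open>W\<close>.\<close>
  obtain w where w: "w \<noteq> z" "w \<in> cball z r"
    using r(1) by (metis dist_commute mem_cball order.strict_iff_not vector_choose_dist less_imp_le dist_self order_refl)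
  have seg: "closed_segment z w \<subseteq> W"
    using w r by (meson centre_in_cball closed_segment_subset convex_cball less_imp_le order_trans)
  have zw: "z \<in> W" "w \<in> W" using seg by auto
  define g where "g = \<phi> \<circ> linepath z w"
  have inj: "inj_on \<phi> W" using chart W inj_on_subset by blast
  have g: "arc g" unfolding arc_def
  proof
    show "path g" unfolding g_def
      using seg W(3) chart(4) by (intro path_continuous_image) (auto intro: continuous_on_subset)
    show "inj_on g {0..1}" unfolding g_def
    proof (rule comp_inj_on)
      show "inj_on (linepath z w) {0..1}" using w arc_linepath[of z w] by (simp add: arc_def)
      show "inj_on \<phi> (linepath z w ` {0..1})"
        using seg inj by (simp add: linepath_image_01 inj_on_subset)
    qed
  qed
  have ends: "pathstart g = \<phi> z" "pathfinish g = \<phi> w"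
    by (simp_all add: g_def pathstart_compose pathfinish_compose)
  have im: "path_image g \<subseteq> \<phi> ` W" using seg by (auto simp: g_def path_image_compose)
  have WS: "\<phi> ` W \<subseteq> S" using W(3) chart(6) by blast
  have ne: "\<phi> z \<noteq> \<phi> w" using inj zw w by (auto dest: inj_onD)
  \<comment> \<open>Redefining \<open>crv\<close> at the new edge therefore overwrites no curve of
    \<open>G\<close>.\<close>
  have new: "{a, b} \<notin> edges G" using edges ab by auto
  define pt' where "pt' = pt(a := \<phi> z, b := \<phi> w)"
  have pt'[simp]: "pt' a = \<phi> z" "pt' b = \<phi> w" "\<And>v. v \<in> verts G \<Longrightarrow> pt' v = pt v"
    using ab by (auto simp: pt'_def)
  have img: "pt' ` e = pt ` e" if "e \<in> edges G" for e using edges that by (intro image_cong refl pt'(3)) auto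
  have img2: "pt' ` (e \<inter> e') = pt ` (e \<inter> e')" if "e \<in> edges G" for e e'
    using edges that by (intro image_cong refl pt'(3)) auto
  define crv' where "crv' = crv({a, b} := g)"
  have crv'[simp]: "crv' {a, b} = g" "\<And>e. e \<in> edges G \<Longrightarrow> crv' e = crv e"
    using new by (auto simp: crv'_def)
  have avoid: "path_image g \<inter> path_image (crv e) = {}" if "e \<in> edges G" for e
    using avoid_crv[OF that] im by auto
  have avoid': "pt v \<notin> path_image g" if "v \<in> verts G" for v
    using avoid_pt[OF that] im by force
  show ?thesis unfolding embeddable_def sgraph.simps
  proof (intro exI[of _ pt'] exI[of _ crv'] conjI ballI impI)
    show "inj_on pt' ({a, b} \<union> verts G)"
    proof -
      have "inj_on pt' (verts G)" using pt(1) by (simp cong: inj_on_cong)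
      moreover have "inj_on pt' {a, b}" using ne by (auto simp: inj_on_def)
      moreover have "pt' ` {a, b} \<inter> pt' ` verts G = {}"
        using avoid_pt zw by auto
      ultimately show ?thesis by (simp only: inj_on_Un) blast
    qed
    show "pt' ` ({a, b} \<union> verts G) \<subseteq> S" using pt(2) zw WS by auto
  next
    fix e assume e: "e \<in> insert {a, b} (edges G)"
    show "arc (crv' e)" using e g crv by auto
    show "path_image (crv' e) \<subseteq> S" using e subset_trans[OF im WS] by (elim insertE) (simp_all add: crv(2))
    show "{pathstart (crv' e), pathfinish (crv' e)} = pt' ` e" using e by (elim insertE) (simp_all add: crv(3) ends img)
  next
    fix e v assume "e \<in> insert {a, b} (edges G)" "v \<in> {a, b} \<union> verts G"
      "pt' v \<in> path_image (crv' e)"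
    then show "v \<in> e" using vtx avoid' avoid_crv zw by auto
  next
    fix e e' assume "e \<in> insert {a, b} (edges G)" "e' \<in> insert {a, b} (edges G)" "e \<noteq> e'"
    then show "path_image (crv' e) \<inter> path_image (crv' e') \<subseteq> pt' ` (e \<inter> e')"
      by (elim insertE) (simp_all add: disj avoid Int_commute[of _ "path_image g"] img2)
  qed
qed

text \<open>Induction on \<open>M\<close>. The same chart serves at every stage, because a free open
  piece is found anew inside it. Disjointness of \<open>M\<close> makes the ends of each new edge
  fresh.\<close>

lemma embeddable_add_disjoint_edges:
  fixes G :: "'v sgraph" and S :: "'p::t2_space set" and \<phi> :: "'a::euclidean_space \<Rightarrow> 'p"
  assumes emb: "embeddable G S" and fin: "finite (verts G)" and edges: "edges G \<subseteq> Pow (verts G)"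
    and M: "finite M" "\<And>e. e \<in> M \<Longrightarrow> card e = 2" "\<And>e. e \<in> M \<Longrightarrow> e \<inter> verts G = {}" "disjoint M"
    and chart: "2 \<le> DIM('a)" "open V" "V \<noteq> {}" "continuous_on V \<phi>" "inj_on \<phi> V" "\<phi> ` V \<subseteq> S"
  shows "embeddable \<lparr>verts = \<Union>M \<union> verts G, edges = M \<union> edges G\<rparr> S"
  using M
proof (induction M rule: finite_induct)
  case empty
  then show ?case using emb by (simp add: embeddable_def)
next
  case (insert e M)
  obtain a b where e: "e = {a, b}" "a \<noteq> b" using insert.prems(1)[of e] by (auto simp: card_2_iff)
  have dM: "e \<inter> \<Union>M = {}"
    using insert.prems(3) insert.hyps(2) by (auto simp: disjoint_def)
  \<comment> \<open>Infinite sets have \<open>card\<close> 0, so \<open>card e = 2\<close> forces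
    each edge to be finite.\<close>
  have finM: "finite (\<Union>M)"
    using insert.prems(1) insert.hyps(1) by (metis card.infinite finite_Union insertI2 zero_neq_numeral)
  have "embeddable \<lparr>verts = \<Union>M \<union> verts G, edges = M \<union> edges G\<rparr> S"
    using insert by (simp add: disjoint_def)
  from embeddable_insert_isolated_edge[OF this _ _ e(2) _ _ chart]
  have "embeddable \<lparr>verts = {a, b} \<union> (\<Union>M \<union> verts G), edges = insert {a, b} (M \<union> edges G)\<rparr> S"
    using fin finM edges dM insert.prems(2)[of e] by (auto simp: e)
  then show ?case by (simp add: e Un_assoc)
qed

text \<open>
  The cap on the side of the negative first axis, which no handle meets: the axes of the handles
  have nonnegative first coordinate.
\<close>

definition sphere_chart :: "real \<Rightarrow> complex \<Rightarrow> real ^ 3" where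
  "sphere_chart r z = - sqrt (r\<^sup>2 - (cmod z)\<^sup>2) *\<^sub>R axis 1 1 + Re z *\<^sub>R axis 2 1 + Im z *\<^sub>R axis 3 1"

lemma sphere_chart_nth [simp]:
  "sphere_chart r z $ 1 = - sqrt (r\<^sup>2 - (cmod z)\<^sup>2)" "sphere_chart r z $ 2 = Re z"
  "sphere_chart r z $ 3 = Im z"
  by (simp_all add: sphere_chart_def axis_def)

text \<open>The set \<open>A\<close> is arbitrary because \<open>sqrt\<close> is continuous on the
  whole real line, being extended to negative arguments as an odd function.\<close>

lemma continuous_on_sphere_chart: "continuous_on A (sphere_chart r)"
  unfolding sphere_chart_def by (intro continuous_intros)

lemma inj_sphere_chart: "inj (sphere_chart r)"
  by (rule injI) (metis complex_eqI sphere_chart_nth(2,3))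

text \<open>The first coordinate is \<open>- ?s\<close>, where \<open>?s\<close> squared is at least
  1 - 1/4, so \<open>?s\<close> exceeds the cylinder radius 1/4. The axes sit at first coordinates
  \<open>i\<close> \<ge> 0, hence at distance at least \<open>?s\<close> from the point.\<close>

lemma sphere_chart_in_sphere_with_handles:
  assumes "z \<in> ball 0 (1/2)"
  shows "sphere_chart (real n + 1) z \<in> sphere_with_handles n"
proof -
  let ?r = "real n + 1" and ?s = "sqrt ((real n + 1)\<^sup>2 - (cmod z)\<^sup>2)"
  have z: "(cmod z)\<^sup>2 \<le> 1/4" using assms power_mono[of "cmod z" "1/2" 2] by (simp add: power2_eq_square)
  have r: "?r\<^sup>2 \<ge> 1" by (simp add: one_le_power)
  have s: "?s \<ge> 1/4" using z r by (intro real_le_rsqrt) (simp add: power2_eq_square)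
  have "norm (sphere_chart ?r z) = sqrt (?s\<^sup>2 + (Re z)\<^sup>2 + (Im z)\<^sup>2)"
    by (simp add: norm_vec_def L2_set_def sum_3)
  also have "?s\<^sup>2 = ?r\<^sup>2 - (cmod z)\<^sup>2" using z r by (intro real_sqrt_pow2) linarith
  also have "sqrt (?r\<^sup>2 - (cmod z)\<^sup>2 + (Re z)\<^sup>2 + (Im z)\<^sup>2) = ?r" by (simp add: cmod_power2)
  finally have "norm (sphere_chart ?r z) = ?r" .
  moreover have "axis_dist i (sphere_chart ?r z) \<ge> 1/4" for i
  proof -
    have "1/4 \<le> \<bar>- ?s - real i\<bar>" using s by simp
    also have "\<dots> \<le> axis_dist i (sphere_chart ?r z)"
      unfolding axis_dist_def by (rule real_le_rsqrt) simp
    finally show ?thesis .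
  qed
  ultimately show ?thesis by (simp add: sphere_with_handles_def)
qed

section \<open>Normal forms in the dicyclic group\<close>

text \<open>
  The pair \<open>(k, b)\<close> stands for \<open>y\<^sup>k x\<^sup>b\<close>.  Each letter acts on these normal forms as multiplication
  from the left; this separates the elements of the presented group.
\<close>

fun dic_act :: "nat \<Rightarrow> dic_gen \<times> bool \<Rightarrow> int \<times> bool \<Rightarrow> int \<times> bool" where
  "dic_act n (Y, p) (k, b) = ((if p then k + 1 else k - 1) mod (2 * int n), b)"
| "dic_act n (X, p) (k, b) = ((if b = p then int n - k else - k) mod (2 * int n), \<not> b)"

definition dic_eval :: "nat \<Rightarrow> dic_gen word \<Rightarrow> int \<times> bool" where
  "dic_eval n w = foldr (dic_act n) w (0, False)"

definition dic_states :: "nat \<Rightarrow> (int \<times> bool) set" where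
  "dic_states n = {0..<2 * int n} \<times> UNIV"

lemma dic_act_in_states: "n > 0 \<Longrightarrow> dic_act n g s \<in> dic_states n"
  by (cases "(n, g, s)" rule: dic_act.cases) (auto simp: dic_states_def)

lemma foldr_dic_act_in_states:
  "n > 0 \<Longrightarrow> s \<in> dic_states n \<Longrightarrow> foldr (dic_act n) w s \<in> dic_states n"
  by (induction w) (auto simp: dic_act_in_states)

lemma dic_eval_in_states: "n > 0 \<Longrightarrow> dic_eval n w \<in> dic_states n"
  unfolding dic_eval_def by (rule foldr_dic_act_in_states) (auto simp: dic_states_def)

lemma foldr_dic_act_Y:
  "(k, b) \<in> dic_states n \<Longrightarrow>
    foldr (dic_act n) (replicate m (Y, True)) (k, b) = ((k + int m) mod (2 * int n), b)"
  by (induction m) (auto simp: dic_states_def mod_simps algebra_simps)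

text \<open>The state has to be reduced: every letter reduces the exponent modulo 2n, so an exponent
  outside the range would not be recovered.\<close>

lemma dic_act_cancel:
  assumes "s \<in> dic_states n"
  shows "dic_act n (g, p) (dic_act n (g, \<not> p) s) = s"
proof -
  obtain k b where s: "s = (k, b)" by (cases s)
  show ?thesis
    using assms by (cases g) (auto simp: s dic_states_def mod_simps)
qed

text \<open>The defining relations hold as identities between maps of the states, so the presented
  group acts on them.\<close>

lemma dic_act_relation:
  assumes "(l, r) \<in> dicyclic_relations n" "s \<in> dic_states n"
  shows "foldr (dic_act n) l s = foldr (dic_act n) r s"
proof -
  obtain k b where s: "s = (k, b)" by (cases s)
  have k: "0 \<le> k" "k < 2 * int n" using assms(2) by (auto simp: s dic_states_def)
  show ?thesis
    using assms(1) unfolding dicyclic_relations_def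
  proof (elim insertE emptyE Pair_inject)
    assume "l = replicate (2 * n) (Y, True)" "r = []"
    then show ?thesis using foldr_dic_act_Y[of k b n "2 * n"] k assms(2) by (simp add: s)
  next
    assume "l = [(X, True), (X, True)]" "r = replicate n (Y, True)"
    \<comment> \<open>Acting twice, x adds n to the exponent if \<open>b\<close> is false and
      subtracts n if it is true; modulo 2n these agree.\<close>
    moreover have "(k - int n) mod (2 * int n) = (k + int n) mod (2 * int n)"
      by (simp add: mod_eq_dvd_iff)
    ultimately show ?thesis
      using foldr_dic_act_Y[of k b n n] assms(2) by (auto simp: s mod_simps algebra_simps)
  next
    assume "l = [(X, True), (Y, True), (X, False)]" "r = [(Y, False)]"
    then show ?thesis by (auto simp: s mod_simps algebra_simps)
  qed
qed

text \<open>The state is kept arbitrary because in \<open>u @ l @ v\<close> the relation is applied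
  to whatever state \<open>v\<close> has produced.\<close>

lemma foldr_dic_act_pres_rel:
  assumes "n > 0" "(u, v) \<in> pres_rel (dicyclic_relations n)" "s \<in> dic_states n"
  shows "foldr (dic_act n) u s = foldr (dic_act n) v s"
  using assms(2,3)
proof (induction arbitrary: s rule: pres_rel.induct)
  case (cancel u g b v)
  then show ?case
    using dic_act_cancel[OF foldr_dic_act_in_states[OF assms(1) cancel]] by simp
next
  case (relation l r u v)
  then show ?case
    using dic_act_relation[OF _ foldr_dic_act_in_states[OF assms(1) relation(2)]] by simp
qed simp_all

lemma dic_eval_pres_rel:
  "n > 0 \<Longrightarrow> (u, v) \<in> pres_rel (dicyclic_relations n) \<Longrightarrow> dic_eval n u = dic_eval n v"
  unfolding dic_eval_def by (rule foldr_dic_act_pres_rel) (auto simp: dic_states_def)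

section \<open>Reduction of words to normal form\<close>

text \<open>Conjugation by \<open>x\<close> inverts \<open>y\<close>, hence all its powers. The
  downward half of the induction on the integers uses the companion relation \<open>xy'\<close> for
  the inverse of \<open>y\<close>.\<close>

lemma (in group) int_pow_inverted:
  assumes "x \<in> carrier G" "y \<in> carrier G" and xy: "x \<otimes> y = inv y \<otimes> x"
  shows "x \<otimes> y [^] (k :: int) = y [^] (- k) \<otimes> x"
proof -
  have xy': "x \<otimes> inv y = y \<otimes> x"
    using assms by (metis inv_closed inv_solve_right m_assoc r_inv l_one inv_solve_left m_closed)
  show ?thesis
  proof (induction k rule: int_induct[of _ 0])
    case base
    then show ?case using assms by simp
  next
    case (step1 i)
    have "x \<otimes> y [^] (i + 1) = (x \<otimes> y [^] i) \<otimes> y" using assms by (simp add: int_pow_mult m_assoc)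
    also have "\<dots> = y [^] (- i) \<otimes> (x \<otimes> y)" using step1 assms by (simp add: m_assoc)
    also have "\<dots> = (y [^] (- i) \<otimes> y [^] (- 1 :: int)) \<otimes> x"
      using assms by (simp add: m_assoc int_pow_neg)
    also have "\<dots> = y [^] (- (i + 1)) \<otimes> x"
      using assms int_pow_mult[of y "- i" "- 1"] by simp
    finally show ?case .
  next
    case (step2 i)
    have "x \<otimes> y [^] (i - 1) = (x \<otimes> y [^] i) \<otimes> inv y"
      using assms by (simp add: int_pow_diff m_assoc)
    also have "\<dots> = y [^] (- i) \<otimes> (x \<otimes> inv y)" using step2 assms by (simp add: m_assoc)
    also have "\<dots> = (y [^] (- i) \<otimes> y [^] (1 :: int)) \<otimes> x"
      using assms xy' by (simp add: m_assoc)
    also have "\<dots> = y [^] (- (i - 1)) \<otimes> x"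
      using assms int_pow_mult[of y "- i" 1] by simp
    finally show ?case .
  qed
qed

lemma (in group) int_pow_mod:
  assumes "y \<in> carrier G" "y [^] m = \<one>"
  shows "y [^] (k mod int m) = y [^] k"
proof -
  have "y [^] k = y [^] (int m * (k div int m) + k mod int m)" by simp
  also have "\<dots> = (y [^] int m) [^] (k div int m) \<otimes> y [^] (k mod int m)"
    using assms(1) by (simp only: int_pow_mult int_pow_pow)
  finally show ?thesis using assms by (simp add: int_pow_int)
qed

lemma presented_group_class_power:
  "pres_rel R `` {replicate m (g, True)} = (pres_rel R `` {[(g, True)]}) [^]\<^bsub>presented_group R\<^esub> m"
proof (induction m)
  case 0
  then show ?case
    by (simp add: one_presented_group group.is_monoid[OF group_presented_group] monoid.nat_pow_0)
next
  case (Suc m)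
  \<comment> \<open>\<open>replicate\<close> grows at the front but the power grows by a factor on
    the right, so the last letter is split off.\<close>
  have "replicate (Suc m) (g, True) = replicate m (g, True) @ [(g, True)]"
    by (simp add: replicate_append_same)
  then show ?case
    using Suc group.is_monoid[OF group_presented_group]
    by (simp add: monoid.nat_pow_Suc mult_presented_group[symmetric] del: replicate.simps)
qed

lemma presented_group_class_inverse:
  "pres_rel R `` {[(g, False)]} = inv\<^bsub>presented_group R\<^esub> (pres_rel R `` {[(g, True)]})"
proof -
  interpret group "presented_group R" by (rule group_presented_group)
  have "(pres_rel R `` {[(g, False)]}) \<otimes>\<^bsub>presented_group R\<^esub> (pres_rel R `` {[(g, True)]})
      = \<one>\<^bsub>presented_group R\<^esub>"
    unfolding mult_presented_group one_presented_group pres_class_eq_iff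
    using pres_rel.cancel[of "[]" g False "[]" R] by simp
  then show ?thesis
    by (intro inv_equality[symmetric]) (auto simp: carrier_presented_group)
qed

text \<open>Prepending a letter multiplies the class from the left, and the relations bring the
  product back to the form that \<open>dic_act\<close> computes; the claim follows by induction on
  the word. Thus a class is determined by the evaluation of any of its words.\<close>

lemma dic_class_eq_normal_form:
  fixes n :: nat
  defines "R \<equiv> dicyclic_relations n" and "G \<equiv> dicyclic_group n"
  defines "x \<equiv> pres_rel R `` {[(X, True)]}" and "y \<equiv> pres_rel R `` {[(Y, True)]}"
  shows "pres_rel R `` {w} =
    y [^]\<^bsub>G\<^esub> fst (dic_eval n w) \<otimes>\<^bsub>G\<^esub> (if snd (dic_eval n w) then x else \<one>\<^bsub>G\<^esub>)"
proof -
  have G: "G = presented_group R" by (simp add: G_def R_def dicyclic_group_def)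
  interpret group G unfolding G by (rule group_presented_group)
  have [simp]: "x \<in> carrier G" "y \<in> carrier G"
    by (auto simp: G x_def y_def carrier_presented_group)
  have rel: "pres_rel R `` {l} = pres_rel R `` {r}" if "(l, r) \<in> R" for l r
    using pres_rel.relation[OF that, of "[]" "[]"] by (simp add: pres_class_eq_iff)
  have y2n: "y [^]\<^bsub>G\<^esub> (2 * n) = \<one>\<^bsub>G\<^esub>"
    using rel[of "replicate (2 * n) (Y, True)" "[]"]
    by (simp add: G y_def presented_group_class_power[symmetric] one_presented_group R_def
        dicyclic_relations_def)
  have xx: "x \<otimes>\<^bsub>G\<^esub> x = y [^]\<^bsub>G\<^esub> int n"
    using rel[of "[(X, True), (X, True)]" "replicate n (Y, True)"]
    by (simp add: G y_def x_def presented_group_class_power[symmetric] mult_presented_group int_pow_int R_def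
        dicyclic_relations_def)
  have "x \<otimes>\<^bsub>G\<^esub> (y \<otimes>\<^bsub>G\<^esub> inv\<^bsub>G\<^esub> x) = inv\<^bsub>G\<^esub> y"
    using rel[of "[(X, True), (Y, True), (X, False)]" "[(Y, False)]"]
    by (simp add: G y_def x_def presented_group_class_inverse[symmetric] mult_presented_group R_def
        dicyclic_relations_def)
  then have xy: "x \<otimes>\<^bsub>G\<^esub> y = inv\<^bsub>G\<^esub> y \<otimes>\<^bsub>G\<^esub> x"
    by (metis \<open>x \<in> carrier G\<close> \<open>y \<in> carrier G\<close> inv_closed inv_solve_right' m_assoc m_closed)
  \<comment> \<open>Conjugation by the inverse of x inverts y as well; this serves the letter
    \<open>(X, False)\<close>.\<close>
  have xy': "inv\<^bsub>G\<^esub> x \<otimes>\<^bsub>G\<^esub> y = inv\<^bsub>G\<^esub> y \<otimes>\<^bsub>G\<^esub> inv\<^bsub>G\<^esub> x"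
  proof -
    have "y \<otimes>\<^bsub>G\<^esub> (x \<otimes>\<^bsub>G\<^esub> y) = x" using xy by (simp add: m_assoc[symmetric])
    then have "x \<otimes>\<^bsub>G\<^esub> y \<otimes>\<^bsub>G\<^esub> inv\<^bsub>G\<^esub> x = inv\<^bsub>G\<^esub> y"
      using xy by (simp add: m_assoc)
    then show ?thesis
      by (metis \<open>x \<in> carrier G\<close> \<open>y \<in> carrier G\<close> \<open>y \<otimes>\<^bsub>G\<^esub> (x \<otimes>\<^bsub>G\<^esub> y) = x\<close> inv_closed inv_solve_left inv_solve_right m_assoc m_closed)
  qed
  have pow_mod: "y [^]\<^bsub>G\<^esub> (k mod (2 * int n)) = y [^]\<^bsub>G\<^esub> k" for k
    using int_pow_mod[OF _ y2n, of k] by simp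
  \<comment> \<open>Since x squared is y^n and y^(2n) = 1, the inverse of x again has the form y^n
    x.\<close>
  have invx: "inv\<^bsub>G\<^esub> x = y [^]\<^bsub>G\<^esub> int n \<otimes>\<^bsub>G\<^esub> x"
  proof (rule inv_equality)
    have "y [^]\<^bsub>G\<^esub> int n \<otimes>\<^bsub>G\<^esub> x \<otimes>\<^bsub>G\<^esub> x = y [^]\<^bsub>G\<^esub> (int n + int n)"
      by (simp add: m_assoc xx int_pow_mult[of y "int n" "int n", symmetric])
    also have "\<dots> = y [^]\<^bsub>G\<^esub> int (2 * n)" by simp
    finally show "y [^]\<^bsub>G\<^esub> int n \<otimes>\<^bsub>G\<^esub> x \<otimes>\<^bsub>G\<^esub> x = \<one>\<^bsub>G\<^esub>" using y2n by (simp only: int_pow_int)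
  qed simp_all
  let ?h = "\<lambda>(k, b). y [^]\<^bsub>G\<^esub> (k :: int) \<otimes>\<^bsub>G\<^esub> (if b then x else \<one>\<^bsub>G\<^esub>)"
  \<comment> \<open>The two formulas of \<open>dic_act\<close> for \<open>X\<close>: moving x or its
    inverse past y^k negates k. An extra n arises when x meets x, by x^2 = y^n, and when the inverse
    of x meets no x, by \<open>invx\<close>.\<close>
  have step: "pres_rel R `` {[a]} \<otimes>\<^bsub>G\<^esub> ?h (k, b) = ?h (dic_act n a (k, b))" for a k b
  proof -
    obtain g p where a: "a = (g, p)" by (cases a)
    have cls: "pres_rel R `` {[(Y, True)]} = y" "pres_rel R `` {[(Y, False)]} = inv\<^bsub>G\<^esub> y"
      "pres_rel R `` {[(X, True)]} = x" "pres_rel R `` {[(X, False)]} = inv\<^bsub>G\<^esub> x"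
      by (simp_all add: x_def y_def G presented_group_class_inverse)
    have Y: "y \<otimes>\<^bsub>G\<^esub> y [^]\<^bsub>G\<^esub> k = y [^]\<^bsub>G\<^esub> (k + 1)" "inv\<^bsub>G\<^esub> y \<otimes>\<^bsub>G\<^esub> y [^]\<^bsub>G\<^esub> k = y [^]\<^bsub>G\<^esub> (k - 1)"
      using int_pow_mult[of y 1 k] int_pow_mult[of y "-1" k]
      by (simp_all add: int_pow_neg add.commute)
    have X: "x \<otimes>\<^bsub>G\<^esub> y [^]\<^bsub>G\<^esub> k = y [^]\<^bsub>G\<^esub> (- k) \<otimes>\<^bsub>G\<^esub> x"
      "inv\<^bsub>G\<^esub> x \<otimes>\<^bsub>G\<^esub> y [^]\<^bsub>G\<^esub> k = y [^]\<^bsub>G\<^esub> (- k) \<otimes>\<^bsub>G\<^esub> inv\<^bsub>G\<^esub> x"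
      by (rule int_pow_inverted; simp add: xy xy')+
    have nk: "y [^]\<^bsub>G\<^esub> (- k) \<otimes>\<^bsub>G\<^esub> y [^]\<^bsub>G\<^esub> int n = y [^]\<^bsub>G\<^esub> (int n - k)"
      using int_pow_mult[of y "- k" "int n"] by simp
    show ?thesis
    proof (cases g)
      case Y
      then show ?thesis
        by (cases p) (simp_all add: a cls pow_mod m_assoc[symmetric] \<open>y \<otimes>\<^bsub>G\<^esub> _ = _\<close> \<open>inv\<^bsub>G\<^esub> y \<otimes>\<^bsub>G\<^esub> _ = _\<close>)
    next
      case X
      have "x \<otimes>\<^bsub>G\<^esub> ?h (k, b) = y [^]\<^bsub>G\<^esub> (- k) \<otimes>\<^bsub>G\<^esub> (x \<otimes>\<^bsub>G\<^esub> (if b then x else \<one>\<^bsub>G\<^esub>))"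
        "inv\<^bsub>G\<^esub> x \<otimes>\<^bsub>G\<^esub> ?h (k, b) = y [^]\<^bsub>G\<^esub> (- k) \<otimes>\<^bsub>G\<^esub> (inv\<^bsub>G\<^esub> x \<otimes>\<^bsub>G\<^esub> (if b then x else \<one>\<^bsub>G\<^esub>))"
        using \<open>x \<otimes>\<^bsub>G\<^esub> y [^]\<^bsub>G\<^esub> k = _\<close> \<open>inv\<^bsub>G\<^esub> x \<otimes>\<^bsub>G\<^esub> y [^]\<^bsub>G\<^esub> k = _\<close>
        by (simp_all add: m_assoc[symmetric])
      moreover have "y [^]\<^bsub>G\<^esub> (- k) \<otimes>\<^bsub>G\<^esub> inv\<^bsub>G\<^esub> x = y [^]\<^bsub>G\<^esub> (int n - k) \<otimes>\<^bsub>G\<^esub> x"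
        by (simp add: invx nk[symmetric] m_assoc)
      ultimately show ?thesis
        using X by (cases p; cases b) (simp_all add: a cls pow_mod xx nk)
    qed
  qed
  have "pres_rel R `` {w} = ?h (dic_eval n w)"
  proof (induction w)
    case Nil
    then show ?case by (simp add: dic_eval_def flip: G one_presented_group)
  next
    case (Cons a w)
    have "pres_rel R `` {a # w} = pres_rel R `` {[a]} \<otimes>\<^bsub>G\<^esub> pres_rel R `` {w}"
      by (simp add: G mult_presented_group)
    also have "\<dots> = ?h (dic_eval n (a # w))"
      using step[of a "fst (dic_eval n w)" "snd (dic_eval n w)"] Cons
      by (simp add: dic_eval_def)
    finally show ?case .
  qed
  then show ?thesis by (simp add: case_prod_beta)
qed

text \<open>Invariance of the action under the relations gives one direction, reduction to normal
  form the other: \<open>dic_eval\<close> is a complete invariant.\<close>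

lemma dic_class_eq_iff:
  assumes "n > 0"
  shows "pres_rel (dicyclic_relations n) `` {u} = pres_rel (dicyclic_relations n) `` {v}
    \<longleftrightarrow> dic_eval n u = dic_eval n v"
proof
  show "dic_eval n u = dic_eval n v"
    if "pres_rel (dicyclic_relations n) `` {u} = pres_rel (dicyclic_relations n) `` {v}"
    using that dic_eval_pres_rel[OF assms] by (simp only: pres_class_eq_iff)
  show "pres_rel (dicyclic_relations n) `` {u} = pres_rel (dicyclic_relations n) `` {v}"
    if "dic_eval n u = dic_eval n v"
    by (simp only: that dic_class_eq_normal_form[of n u] dic_class_eq_normal_form[of n v])
qed

section \<open>Multiplication and commutation of normal forms\<close>

text \<open>Positive letters suffice, and \<open>nat\<close> loses nothing, because the exponents in
  \<open>dic_states\<close> are non-negative.\<close>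

definition dic_word :: "int \<times> bool \<Rightarrow> dic_gen word" where
  "dic_word s = replicate (nat (fst s)) (Y, True) @ (if snd s then [(X, True)] else [])"

definition dic_elem :: "nat \<Rightarrow> int \<times> bool \<Rightarrow> dic_gen word set" where
  "dic_elem n s = pres_rel (dicyclic_relations n) `` {dic_word s}"

lemma dic_eval_word:
  assumes "s \<in> dic_states n"
  shows "dic_eval n (dic_word s) = s"
proof -
  have "(0, b) \<in> dic_states n" for b using assms by (auto simp: dic_states_def)
  then show ?thesis
    using assms foldr_dic_act_Y[of 0 "snd s" n "nat (fst s)"]
    by (cases s) (auto simp: dic_eval_def dic_word_def dic_states_def)
qed

text \<open>The multiplication table: an x on the left negates the exponent \<open>l\<close> that it
  passes, and two factors x combine to y^n.\<close>

lemma dic_eval_word_append: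
  assumes "(k, b) \<in> dic_states n" "(l, c) \<in> dic_states n"
  shows "dic_eval n (dic_word (k, b) @ dic_word (l, c)) =
    ((k + (if b then (if c then int n - l else - l) else l)) mod (2 * int n), b \<noteq> c)"
proof -
  have n: "n > 0" using assms by (auto simp: dic_states_def)
  have "dic_eval n (dic_word (k, b) @ dic_word (l, c)) = foldr (dic_act n) (dic_word (k, b)) (l, c)"
    using dic_eval_word[OF assms(2)] by (simp add: dic_eval_def)
  also have "\<dots> = foldr (dic_act n) (replicate (nat k) (Y, True)) (if b then dic_act n (X, True) (l, c) else (l, c))"
    by (simp add: dic_word_def)
  also have "\<dots> = ((k + (if b then (if c then int n - l else - l) else l)) mod (2 * int n), b \<noteq> c)"
    using foldr_dic_act_Y[of _ _ n "nat k"] dic_act_in_states[OF n, of "(X, True)" "(l, c)"] assms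
    by (auto simp: dic_states_def mod_simps algebra_simps)
  finally show ?thesis .
qed

lemma inj_on_dic_elem: "inj_on (dic_elem n) (dic_states n)"
proof (rule inj_onI)
  fix s t assume st: "s \<in> dic_states n" "t \<in> dic_states n" "dic_elem n s = dic_elem n t"
  then have "n > 0" by (auto simp: dic_states_def)
  with st show "s = t" by (simp add: dic_elem_def dic_class_eq_iff dic_eval_word)
qed

lemma carrier_dicyclic_group:
  assumes "n > 0"
  shows "carrier (dicyclic_group n) = dic_elem n ` dic_states n"
proof -
  have "pres_rel (dicyclic_relations n) `` {w} = dic_elem n (dic_eval n w)" for w
    unfolding dic_elem_def dic_class_eq_iff[OF assms]
    using dic_eval_word dic_eval_in_states[OF assms] by metis
  then show ?thesis
    using dic_eval_in_states[OF assms]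
    by (auto simp: dicyclic_group_def carrier_presented_group dic_elem_def)
qed

text \<open>In the table the exponents of the two products differ by an even number, so a congruence
  modulo 2n halves to a divisibility by n.\<close>

lemma dic_elem_commute_iff:
  assumes "(k, b) \<in> dic_states n" "(l, c) \<in> dic_states n"
  shows "dic_elem n (k, b) \<otimes>\<^bsub>dicyclic_group n\<^esub> dic_elem n (l, c) =
      dic_elem n (l, c) \<otimes>\<^bsub>dicyclic_group n\<^esub> dic_elem n (k, b) \<longleftrightarrow>
    (if b then if c then int n dvd k - l else int n dvd l else if c then int n dvd k else True)"
proof -
  have n: "n > 0" using assms by (auto simp: dic_states_def)
  have two: "2 * int n dvd 2 * i \<longleftrightarrow> int n dvd i" for i by simp
  have "dic_elem n (k, b) \<otimes>\<^bsub>dicyclic_group n\<^esub> dic_elem n (l, c) =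
      dic_elem n (l, c) \<otimes>\<^bsub>dicyclic_group n\<^esub> dic_elem n (k, b) \<longleftrightarrow>
    dic_eval n (dic_word (k, b) @ dic_word (l, c)) = dic_eval n (dic_word (l, c) @ dic_word (k, b))"
    by (simp only: dic_elem_def dicyclic_group_def mult_presented_group dic_class_eq_iff[OF n])
  also have "\<dots> \<longleftrightarrow>
    (if b then if c then 2 * int n dvd 2 * (k - l) else 2 * int n dvd 2 * l
     else if c then 2 * int n dvd 2 * k else True)"
    unfolding dic_eval_word_append[OF assms] dic_eval_word_append[OF assms(2,1)]
    by (cases b; cases c) (simp_all add: mod_eq_dvd_iff algebra_simps)
  finally show ?thesis unfolding two .
qed

section \<open>The commuting graph of the dicyclic group\<close>

lemma dvd_in_range_iff:
  fixes n k :: int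
  assumes "0 \<le> k" "k < 2 * n"
  shows "n dvd k \<longleftrightarrow> k = 0 \<or> k = n"
proof
  assume "n dvd k"
  then obtain q where q: "k = n * q" by blast
  have "n > 0" using assms by simp
  have "q \<ge> 0" using assms(1) \<open>n > 0\<close> by (simp add: q zero_le_mult_iff)
  moreover have "q < 2" using assms(2) \<open>n > 0\<close> by (simp add: q mult.commute)
  ultimately have "q = 0 \<or> q = 1" by linarith
  then show "k = 0 \<or> k = n" by (auto simp: q)
qed auto

text \<open>Two test elements decide centrality. The element y excludes every y^k x, as n \<ge> 2
  does not divide 1; then x leaves only those y^k with n dividing k.\<close>

lemma group_center_dicyclic_group:
  assumes "n \<ge> 2"
  shows "group_center (dicyclic_group n) = dic_elem n ` {(0, False), (int n, False)}"
proof -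
  have n: "n > 0" using assms by simp
  have "(\<forall>t\<in>dic_states n. dic_elem n s \<otimes>\<^bsub>dicyclic_group n\<^esub> dic_elem n t =
      dic_elem n t \<otimes>\<^bsub>dicyclic_group n\<^esub> dic_elem n s) \<longleftrightarrow> s \<in> {(0, False), (int n, False)}"
    if s: "s \<in> dic_states n" for s
  proof -
    obtain k b where [simp]: "s = (k, b)" by (cases s)
    have k: "0 \<le> k" "k < 2 * int n" using s by (auto simp: dic_states_def)
    have y: "(1, False) \<in> dic_states n" "(0, True) \<in> dic_states n"
      using assms by (auto simp: dic_states_def)
    show ?thesis
    proof (cases b)
      case True
      then show ?thesis using dic_elem_commute_iff[OF _ y(1), of k b] s y assms by force
    next
      case False
      have "(\<forall>t\<in>dic_states n. dic_elem n s \<otimes>\<^bsub>dicyclic_group n\<^esub> dic_elem n t =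
        dic_elem n t \<otimes>\<^bsub>dicyclic_group n\<^esub> dic_elem n s) \<longleftrightarrow> int n dvd k"
      proof
        assume "\<forall>t\<in>dic_states n. dic_elem n s \<otimes>\<^bsub>dicyclic_group n\<^esub> dic_elem n t =
          dic_elem n t \<otimes>\<^bsub>dicyclic_group n\<^esub> dic_elem n s"
        then show "int n dvd k" using dic_elem_commute_iff[OF _ y(2), of k b] s y(2) False by simp
      next
        assume dvd: "int n dvd k"
        show "\<forall>t\<in>dic_states n. dic_elem n s \<otimes>\<^bsub>dicyclic_group n\<^esub> dic_elem n t =
          dic_elem n t \<otimes>\<^bsub>dicyclic_group n\<^esub> dic_elem n s"
        proof
          fix t assume t: "t \<in> dic_states n"
          obtain l c where [simp]: "t = (l, c)" by (cases t)
          show "dic_elem n s \<otimes>\<^bsub>dicyclic_group n\<^esub> dic_elem n t =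
            dic_elem n t \<otimes>\<^bsub>dicyclic_group n\<^esub> dic_elem n s"
            using dic_elem_commute_iff[of k b n l c] s t False dvd by simp
        qed
      qed
      then show ?thesis using False dvd_in_range_iff[OF k] by auto
    qed
  qed
  moreover have "{(0, False), (int n, False)} \<subseteq> dic_states n" using n by (auto simp: dic_states_def)
  ultimately show ?thesis
    unfolding group_center_def carrier_dicyclic_group[OF n] by blast
qed

text \<open>\<open>C\<close> consists of the noncentral powers of y, and \<open>M\<close> pairs y^k
  x with y^(k+n) x. Powers of y commute with each other, two elements outside them commute when
  their exponents agree modulo n, and a mixed noncentral pair never commutes.\<close>

lemma commuting_graph_dicyclic_group:
  fixes n :: nat
  assumes "n \<ge> 2"
  defines "C \<equiv> dic_elem n ` (({0<..<2 * int n} - {int n}) \<times> {False})"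
    and "M \<equiv> (\<lambda>k. dic_elem n ` {(k, True), (k + int n, True)}) ` {0..<int n}"
  shows "commuting_graph (dicyclic_group n) = \<lparr>verts = \<Union>M \<union> C, edges = M \<union> edges (complete_graph C)\<rparr>"
proof -
  let ?G = "dicyclic_group n"
  let ?C = "({0<..<2 * int n} - {int n}) \<times> {False}" and ?T = "{0..<2 * int n} \<times> {True}"
  have n: "n > 0" using assms by simp
  have C: "?C \<subseteq> dic_states n" and T: "?T \<subseteq> dic_states n" by (auto simp: dic_states_def)
  have "carrier ?G - group_center ?G = dic_elem n ` (dic_states n - {(0, False), (int n, False)})"
    unfolding carrier_dicyclic_group[OF n] group_center_dicyclic_group[OF assms(1)]
    by (rule inj_on_image_set_diff[OF inj_on_dic_elem, symmetric]) (use n in \<open>auto simp: dic_states_def\<close>)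
  also have "dic_states n - {(0, False), (int n, False)} = ?T \<union> ?C"
    by (auto simp: dic_states_def)
  finally have V: "carrier ?G - group_center ?G = dic_elem n ` (?T \<union> ?C)" .
  have UM: "\<Union>M = dic_elem n ` ?T"
  proof -
    \<comment> \<open>Each exponent below 2n is \<open>k\<close> or \<open>k + n\<close> for some
      \<open>k\<close> below n; those in the upper half take \<open>k - int n\<close> as
      index.\<close>
    have "(\<Union>k\<in>{0..<int n}. {(k, True), (k + int n, True)}) = ?T"
    proof (intro equalityI subsetI)
      fix s assume "s \<in> ?T"
      then obtain k where k: "s = (k, True)" "0 \<le> k" "k < 2 * int n" by auto
      then show "s \<in> (\<Union>k\<in>{0..<int n}. {(k, True), (k + int n, True)})"
        by (cases "k < int n") (auto intro: bexI[of _ "k - int n"])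
    qed auto
    then show ?thesis unfolding M_def by blast
  qed
  have "{{x, y} | x y. x \<in> dic_elem n ` (?T \<union> ?C) \<and> y \<in> dic_elem n ` (?T \<union> ?C) \<and> x \<noteq> y
      \<and> x \<otimes>\<^bsub>?G\<^esub> y = y \<otimes>\<^bsub>?G\<^esub> x} = M \<union> edges (complete_graph C)" (is "?L = ?R")
  proof (intro equalityI subsetI)
    fix e assume "e \<in> ?L"
    then obtain x y where "e = {x, y}" "x \<in> dic_elem n ` (?T \<union> ?C)" "y \<in> dic_elem n ` (?T \<union> ?C)"
      "x \<noteq> y" "x \<otimes>\<^bsub>?G\<^esub> y = y \<otimes>\<^bsub>?G\<^esub> x"
      by blast
    then obtain s t where e: "e = {dic_elem n s, dic_elem n t}" and s: "s \<in> ?T \<union> ?C" and t: "t \<in> ?T \<union> ?C"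
      and ne: "dic_elem n s \<noteq> dic_elem n t"
      and comm: "dic_elem n s \<otimes>\<^bsub>?G\<^esub> dic_elem n t = dic_elem n t \<otimes>\<^bsub>?G\<^esub> dic_elem n s"
      by (elim imageE) metis
    obtain k b l c where st: "s = (k, b)" "t = (l, c)" by (cases s; cases t)
    have states: "(k, b) \<in> dic_states n" "(l, c) \<in> dic_states n" using s t C T st by auto
    note comm' = comm[unfolded st dic_elem_commute_iff[OF states]]
    have k: "0 \<le> k" "k < 2 * int n" and l: "0 \<le> l" "l < 2 * int n"
      using states by (auto simp: dic_states_def)
    consider "b" "c" | "\<not> b" "\<not> c" | "b \<noteq> c" by blast
    then show "e \<in> ?R"
    proof cases
      case 1
      have "k \<noteq> l" using ne 1 st by auto
      \<comment> \<open>The absolute value brings the difference into the range from 0 to 2n that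
        \<open>dvd_in_range_iff\<close> expects.\<close>
      have dvd: "int n dvd \<bar>k - l\<bar>" using comm' 1 by simp
      have "\<bar>k - l\<bar> = int n"
        using dvd_in_range_iff[of "\<bar>k - l\<bar>" "int n"] dvd k l \<open>k \<noteq> l\<close> by linarith
      then have "l = k + int n \<or> k = l + int n" by linarith
      \<comment> \<open>\<open>M\<close> indexes an edge by its smaller exponent, which lies below n
        because the larger one lies below 2n.\<close>
      then have "e = dic_elem n ` {(min k l, True), (min k l + int n, True)}" "min k l \<in> {0..<int n}"
        using k l 1 by (auto simp: e st)
      then show ?thesis unfolding M_def by blast
    next
      case 2
      then have "s \<in> ?C" "t \<in> ?C" using s t st by auto
      then have "dic_elem n s \<in> C" "dic_elem n t \<in> C" unfolding C_def by blast+
      then show ?thesis using ne unfolding e complete_graph_def by auto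
    next
      case 3
      \<comment> \<open>Commuting would force n to divide the exponent of the power of y, but
        exponents 0 and n are excluded from \<open>?C\<close>.\<close>
      then have False
        using comm' s t dvd_in_range_iff[OF k] dvd_in_range_iff[OF l]
        by (cases b; cases c) (auto simp: st)
      then show ?thesis ..
    qed
  next
    fix e assume "e \<in> ?R"
    then show "e \<in> ?L"
    proof
      assume "e \<in> M"
      then obtain k where k: "0 \<le> k" "k < int n" and e: "e = dic_elem n ` {(k, True), (k + int n, True)}"
        unfolding M_def by auto
      let ?s = "(k, True)" and ?t = "(k + int n, True)"
      have st: "?s \<in> ?T" "?t \<in> ?T" using k by auto
      then have states: "?s \<in> dic_states n" "?t \<in> dic_states n" using T by blast+
      have "dic_elem n ?s \<noteq> dic_elem n ?t"
        using inj_onD[OF inj_on_dic_elem _ states] n by auto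
      moreover have "dic_elem n ?s \<otimes>\<^bsub>?G\<^esub> dic_elem n ?t = dic_elem n ?t \<otimes>\<^bsub>?G\<^esub> dic_elem n ?s"
        by (simp add: dic_elem_commute_iff[OF states])
      ultimately show ?thesis using st e by blast
    next
      assume "e \<in> edges (complete_graph C)"
      then obtain x y where e: "e = {x, y}" "x \<in> C" "y \<in> C" "x \<noteq> y"
        by (auto simp: complete_graph_def)
      then obtain s t where st: "x = dic_elem n s" "y = dic_elem n t" "s \<in> ?C" "t \<in> ?C"
        unfolding C_def by blast
      obtain k l where kl: "s = (k, False)" "t = (l, False)" using st by auto
      have "x \<otimes>\<^bsub>?G\<^esub> y = y \<otimes>\<^bsub>?G\<^esub> x"
        using st C unfolding st(1,2) kl by (subst dic_elem_commute_iff) auto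
      then show ?thesis using e st by blast
    qed
  qed
  then show ?thesis
    unfolding commuting_graph_def V UM C_def by (simp add: image_Un)
qed

text \<open>By injectivity of \<open>dic_elem\<close> on states, everything is checked on index
  pairs. Those with \<open>k\<close> below n are disjoint from each other, and their second
  component separates them from the powers of y.\<close>

lemma dic_elem_edges_disjoint:
  fixes n :: nat
  assumes "n > 0"
  defines "M \<equiv> (\<lambda>k. dic_elem n ` {(k, True), (k + int n, True)}) ` {0..<int n}"
  shows "disjoint M" "\<And>e. e \<in> M \<Longrightarrow> card e = 2"
    "\<And>e. e \<in> M \<Longrightarrow> e \<inter> dic_elem n ` (({0<..<2 * int n} - {int n}) \<times> {False}) = {}"
proof -
  let ?p = "\<lambda>k. {(k, True), (k + int n, True)}"
  have p: "?p k \<subseteq> dic_states n" if "k \<in> {0..<int n}" for k using that by (auto simp: dic_states_def)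
  have disj: "dic_elem n ` A \<inter> dic_elem n ` B = {}"
    if "A \<subseteq> dic_states n" "B \<subseteq> dic_states n" "A \<inter> B = {}" for A B
    using inj_on_image_Int[OF inj_on_dic_elem that(1,2)] that(3) by simp
  show "disjoint M"
  proof (rule disjointI)
    fix e f assume "e \<in> M" "f \<in> M" "e \<noteq> f"
    then obtain k l where kl: "k \<in> {0..<int n}" "l \<in> {0..<int n}" "k \<noteq> l"
      "e = dic_elem n ` ?p k" "f = dic_elem n ` ?p l"
      unfolding M_def by blast
    show "e \<inter> f = {}" unfolding kl(4,5) by (rule disj[OF p p]) (use kl in auto)
  qed
  fix e assume "e \<in> M"
  then obtain k where k: "k \<in> {0..<int n}" "e = dic_elem n ` ?p k" unfolding M_def by blast
  show "card e = 2"
    unfolding k(2) using card_image[OF inj_on_subset[OF inj_on_dic_elem p[OF k(1)]]] assms by simp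
  show "e \<inter> dic_elem n ` (({0<..<2 * int n} - {int n}) \<times> {False}) = {}"
    unfolding k(2) by (rule disj[OF p[OF k(1)]]) (auto simp: dic_states_def)
qed

theorem proposition4p2:
  fixes n :: nat
  assumes "n \<ge> 2"
  shows "genus (commuting_graph (dicyclic_group n)) = genus (complete_graph {..<2 * (n - 1)})"
proof -
  let ?C' = "({0<..<2 * int n} - {int n}) \<times> {False}"
  define C where "C = dic_elem n ` ?C'"
  define M where "M = (\<lambda>k. dic_elem n ` {(k, True), (k + int n, True)}) ` {0..<int n}"
  have n: "n > 0" using assms by simp
  have finC: "finite C" by (simp add: C_def)
  have "card C = card ?C'"
    unfolding C_def
    by (rule card_image[OF inj_on_subset[OF inj_on_dic_elem]]) (auto simp: dic_states_def)
  \<comment> \<open>There are 2n - 1 integers strictly between 0 and 2n, and one of them, n, is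
    removed.\<close>
  also have "\<dots> = 2 * (n - 1)"
    using n by (simp add: card_cartesian_product card_Diff_singleton)
  finally have cardC: "card C = card {..<2 * (n - 1)}" by simp
  have graph: "commuting_graph (dicyclic_group n) =
      \<lparr>verts = \<Union>M \<union> verts (complete_graph C), edges = M \<union> edges (complete_graph C)\<rparr>"
    using commuting_graph_dicyclic_group[OF assms] by (simp add: C_def M_def complete_graph_def)
  have sub: "edges (complete_graph C) \<subseteq> Pow (verts (complete_graph C))"
    by (auto simp: complete_graph_def)
  \<comment> \<open>An equivalence for each number of handles \<open>g\<close> makes both
    \<open>LEAST\<close> expressions refer to the same predicate.\<close>
  have "embeddable (commuting_graph (dicyclic_group n)) (sphere_with_handles g) \<longleftrightarrow>
      embeddable (complete_graph C) (sphere_with_handles g)" for g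
  proof
    assume "embeddable (commuting_graph (dicyclic_group n)) (sphere_with_handles g)"
    then show "embeddable (complete_graph C) (sphere_with_handles g)"
      \<comment> \<open>The complete graph on \<open>C\<close> is a subgraph, so the drawing is
        restricted.\<close>
      by (rule embeddable_vertex_map[where f = id]) (use sub in \<open>auto simp: graph\<close>)
  next
    assume emb: "embeddable (complete_graph C) (sphere_with_handles g)"
    show "embeddable (commuting_graph (dicyclic_group n)) (sphere_with_handles g)"
      unfolding graph
    proof (rule embeddable_add_disjoint_edges[OF emb _ sub,
          where V = "ball 0 (1/2)" and \<phi> = "sphere_chart (real g + 1)"])
      show "finite (verts (complete_graph C))" using finC by (simp add: complete_graph_def)
      show "finite M" by (simp add: M_def)
      show "disjoint M" "\<And>e. e \<in> M \<Longrightarrow> card e = 2"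
        "\<And>e. e \<in> M \<Longrightarrow> e \<inter> verts (complete_graph C) = {}"
        using dic_elem_edges_disjoint[OF n] by (simp_all add: M_def C_def complete_graph_def)
      show "inj_on (sphere_chart (real g + 1)) (ball 0 (1/2))"
        using inj_sphere_chart inj_on_subset by blast
      show "sphere_chart (real g + 1) ` ball 0 (1/2) \<subseteq> sphere_with_handles g"
        using sphere_chart_in_sphere_with_handles by blast
    qed (simp_all add: continuous_on_sphere_chart)
  qed
  then show ?thesis
    unfolding genus_def
    by (simp only: embeddable_complete_graph_card[OF finC finite_lessThan cardC])
qed

end
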